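(* Let $1\le p\le\infty$, and let $u,\psi$ be entire functions on $\mathbb{C}$ such that the weighted composition operator $W_{(u,\psi)}$ is bounded on the Fock space $\mathcal{F}_p$. Suppose $\psi(z)=az+b$ with $a,b\in\mathbb{C}$, $|a|=1$, $a$ not a root of unity, and $u\big(\frac{b}{1-a}\big)=1$ (and hence $|u(0)|=e^{-\frac{|b|^2}{2}}$). Then $W_{(u,\psi)}$ is not uniformly mean ergodic on $\mathcal{F}_p$.
   Context: For $1\le p<\infty$, the Fock space $\mathcal{F}_p$ consists of all entire functions $f$ on $\mathbb{C}$ with $\|f\|_p=\Big(\frac{p}{2\pi}\int_{\mathbb{C}}|f(z)|^pe^{-\frac{p|z|^2}{2}}dA(z)\Big)^{1/p}<\infty$, where $dA$ is Lebesgue area measure; $\mathcal{F}_\infty$ consists of all entire $f$ with $\|f\|_\infty=\sup_{z\in\mathbb{C}}|f(z)|e^{-\frac{|z|^2}{2}}<\infty$. For entire $u,\psi$, the weighted composition operator is $W_{(u,\psi)}f=u\cdot (f\circ\psi)$. A bounded operator $T$ on a Banach space $X$ is uniformly mean ergodic if there is a bounded operator $P$ on $X$ with $\lim_{n\to\infty}\big\|\frac1n\sum_{m=1}^nT^m-P\big\|=0$ in operator norm. *)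

theory Defs
  imports "HOL-Complex_Analysis.Complex_Analysis"
begin

text \<open>
  The Fock spaces are carrier sets of entire functions together with a norm. The exponent
  ranges over \<^typ>\<open>ennreal\<close>, so that the case \<open>p = \<infinity>\<close> is included; only exponents \<open>1 \<le> p\<close>
  are meant.
\<close>

text \<open>
  The integrand below is nonnegative and, for entire \<open>f\<close>, continuous, so its integrability
  is finiteness of the integral in the norm. The measure \<^term>\<open>lborel :: complex measure\<close>
  is area measure on the plane.
\<close>

definition fock_space :: "ennreal \<Rightarrow> (complex \<Rightarrow> complex) set" where
  "fock_space p = {f. f holomorphic_on UNIV \<and>
     (if p = \<infinity> then bdd_above (range (\<lambda>z. cmod (f z) * exp (- ((cmod z)\<^sup>2 / 2))))
      else integrable lborel
             (\<lambda>z. cmod (f z) powr enn2real p * exp (- (enn2real p * (cmod z)\<^sup>2 / 2))))}"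

definition fock_norm :: "ennreal \<Rightarrow> (complex \<Rightarrow> complex) \<Rightarrow> real" where
  "fock_norm p f =
     (if p = \<infinity> then (SUP z. cmod (f z) * exp (- ((cmod z)\<^sup>2 / 2)))
      else (enn2real p / (2 * pi) *
             (\<integral>z. cmod (f z) powr enn2real p * exp (- (enn2real p * (cmod z)\<^sup>2 / 2)) \<partial>lborel))
           powr (1 / enn2real p))"

definition weighted_comp ::
    "(complex \<Rightarrow> complex) \<Rightarrow> (complex \<Rightarrow> complex) \<Rightarrow> (complex \<Rightarrow> complex) \<Rightarrow> (complex \<Rightarrow> complex)" where
  "weighted_comp u \<psi> f = (\<lambda>z. u z * f (\<psi> z))"

text \<open>
  Operators on a space \<open>X\<close> of complex-valued functions with norm \<open>N\<close>. They are represented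
  by total functions, of which only the values on \<open>X\<close> matter.
\<close>

definition bounded_operator ::
    "('a \<Rightarrow> complex) set \<Rightarrow> (('a \<Rightarrow> complex) \<Rightarrow> real) \<Rightarrow>
     (('a \<Rightarrow> complex) \<Rightarrow> ('a \<Rightarrow> complex)) \<Rightarrow> bool" where
  "bounded_operator X N T \<longleftrightarrow>
     (\<forall>f\<in>X. T f \<in> X) \<and>
     (\<forall>f\<in>X. \<forall>g\<in>X. T (\<lambda>z. f z + g z) = (\<lambda>z. T f z + T g z)) \<and>
     (\<forall>c. \<forall>f\<in>X. T (\<lambda>z. c * f z) = (\<lambda>z. c * T f z)) \<and>
     (\<exists>C. \<forall>f\<in>X. N (T f) \<le> C * N f)"

text \<open>The supremum is meaningful (taken over a set bounded above) for bounded operators.\<close>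

definition operator_norm ::
    "('a \<Rightarrow> complex) set \<Rightarrow> (('a \<Rightarrow> complex) \<Rightarrow> real) \<Rightarrow>
     (('a \<Rightarrow> complex) \<Rightarrow> ('a \<Rightarrow> complex)) \<Rightarrow> real" where
  "operator_norm X N T = (SUP f\<in>{f\<in>X. N f \<le> 1}. N (T f))"

definition cesaro_mean ::
    "(('a \<Rightarrow> complex) \<Rightarrow> ('a \<Rightarrow> complex)) \<Rightarrow> nat \<Rightarrow> (('a \<Rightarrow> complex) \<Rightarrow> ('a \<Rightarrow> complex))" where
  "cesaro_mean T n f = (\<lambda>z. (\<Sum>m=1..n. (T ^^ m) f z) / of_nat n)"

definition uniformly_mean_ergodic ::
    "('a \<Rightarrow> complex) set \<Rightarrow> (('a \<Rightarrow> complex) \<Rightarrow> real) \<Rightarrow>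
     (('a \<Rightarrow> complex) \<Rightarrow> ('a \<Rightarrow> complex)) \<Rightarrow> bool" where
  "uniformly_mean_ergodic X N T \<longleftrightarrow>
     bounded_operator X N T \<and>
     (\<exists>P. bounded_operator X N P \<and>
        (\<lambda>n. operator_norm X N (\<lambda>f z. cesaro_mean T n f z - P f z)) \<longlonglongrightarrow> 0)"

end

theory Submission
  imports Defs "HOL-Probability.Distributions"
begin

text \<open>
  Boundedness on the normalised reproducing kernels and Liouville's theorem force
  \<open>u z = u 0 * exp (- a * cnj b * z)\<close>. With the fixed point \<open>w = b / (1 - a)\<close> of \<open>\<psi>\<close>, the functions
  \<open>(z - w) ^ k * exp (cnj w * z)\<close> are then eigenvectors with eigenvalues \<open>a ^ k\<close>. If the Cesaro means
  converged in norm, the means of the powers of \<open>a ^ k\<close> would tend to \<open>0\<close> uniformly in \<open>k > 0\<close>;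
  but \<open>a ^ k\<close> comes arbitrarily close to \<open>1\<close>. A quasi-triangle inequality suffices, so Minkowski's
  inequality is avoided, and the point evaluation bound comes from \<open>x \<le> 1 + x powr q\<close>, which
  replaces Jensen's and Hoelder's inequalities.
\<close>

section \<open>Area measure on the plane: Fubini, shears and rotations\<close>

text \<open>Lebesgue measure is determined by its values on open boxes, and a complex box is a
  product of two intervals. This opens the way to iterated integrals over real and imaginary
  parts.\<close>

lemma lborel_complex_eq_distr_pair:
  "(lborel :: complex measure) = distr (lborel \<Otimes>\<^sub>M lborel) borel (\<lambda>(x, y). Complex x y)"
proof (rule lborel_eqI)
  have [measurable]: "(\<lambda>(x, y). Complex x y) \<in> borel_measurable (lborel \<Otimes>\<^sub>M lborel)"
    unfolding Complex_eq by measurable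
  fix l u :: complex
  assume le: "\<And>b. b \<in> Basis \<Longrightarrow> l \<bullet> b \<le> u \<bullet> b"
  have le': "Re l \<le> Re u" "Im l \<le> Im u"
    using le[of 1] le[of \<i>] by (auto simp: Basis_complex_def)
  have vimage: "(\<lambda>(x, y). Complex x y) -` box l u = {Re l<..<Re u} \<times> {Im l<..<Im u}"
    by (auto simp: in_box_complex_iff)
  have "emeasure (distr (lborel \<Otimes>\<^sub>M lborel) borel (\<lambda>(x, y). Complex x y)) (box l u) =
      emeasure (lborel \<Otimes>\<^sub>M lborel) ({Re l<..<Re u} \<times> {Im l<..<Im u})"
    by (subst emeasure_distr) (auto simp: vimage space_pair_measure)
  also have "\<dots> = ennreal (Re u - Re l) * ennreal (Im u - Im l)"
    using le' by (subst lborel.emeasure_pair_measure_Times) auto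
  also have "\<dots> = (\<Prod>b\<in>Basis. (u - l) \<bullet> b)"
    using le' by (simp add: Basis_complex_def ennreal_mult' inner_diff_left)
  finally show "emeasure (distr (lborel \<Otimes>\<^sub>M lborel) borel (\<lambda>(x, y). Complex x y)) (box l u) =
      (\<Prod>b\<in>Basis. (u - l) \<bullet> b)" .
qed simp

lemma borel_measurable_Complex [measurable (raw)]:
  assumes "f \<in> borel_measurable M" "g \<in> borel_measurable M"
  shows "(\<lambda>x. Complex (f x) (g x)) \<in> borel_measurable M"
  using assms unfolding Complex_eq by measurable

lemma nn_integral_lborel_complex:
  fixes F :: "complex \<Rightarrow> ennreal"
  assumes [measurable]: "F \<in> borel_measurable borel"
  shows "(\<integral>\<^sup>+z. F z \<partial>lborel) = (\<integral>\<^sup>+x. \<integral>\<^sup>+y. F (Complex x y) \<partial>lborel \<partial>lborel)"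
proof -
  have "(\<integral>\<^sup>+z. F z \<partial>lborel) = (\<integral>\<^sup>+(x, y). F (Complex x y) \<partial>(lborel \<Otimes>\<^sub>M lborel))"
    by (subst lborel_complex_eq_distr_pair, subst nn_integral_distr) (auto simp: case_prod_unfold)
  also have "\<dots> = (\<integral>\<^sup>+x. \<integral>\<^sup>+y. F (Complex x y) \<partial>lborel \<partial>lborel)"
    by (subst lborel.nn_integral_fst[symmetric]) auto
  finally show ?thesis .
qed

lemma nn_integral_lborel_complex':
  fixes F :: "complex \<Rightarrow> ennreal"
  assumes [measurable]: "F \<in> borel_measurable borel"
  shows "(\<integral>\<^sup>+z. F z \<partial>lborel) = (\<integral>\<^sup>+y. \<integral>\<^sup>+x. F (Complex x y) \<partial>lborel \<partial>lborel)"
  by (subst nn_integral_lborel_complex, simp, subst lborel_pair.Fubini') auto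

lemma nn_integral_lborel_translate:
  fixes F :: "'a::euclidean_space \<Rightarrow> ennreal"
  assumes [measurable]: "F \<in> borel_measurable borel"
  shows "(\<integral>\<^sup>+x. F (x + w) \<partial>lborel) = (\<integral>\<^sup>+x. F x \<partial>lborel)"
proof -
  have "(\<integral>\<^sup>+x. F x \<partial>lborel) = (\<integral>\<^sup>+x. F x \<partial>(distr lborel borel ((+) w)))"
    by (simp add: lborel_distr_plus)
  also have "\<dots> = (\<integral>\<^sup>+x. F (x + w) \<partial>lborel)"
    by (subst nn_integral_distr) (auto simp: add.commute)
  finally show ?thesis by simp
qed

text \<open>For fixed imaginary part the shear is a translation of the real line, so integrate over
  the real part first.\<close>

lemma nn_integral_lborel_complex_shear_Re:
  fixes F :: "complex \<Rightarrow> ennreal"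
  assumes [measurable]: "F \<in> borel_measurable borel"
  shows "(\<integral>\<^sup>+z. F (Complex (Re z + t * Im z) (Im z)) \<partial>lborel) = (\<integral>\<^sup>+z. F z \<partial>lborel)"
  using nn_integral_lborel_translate[of "\<lambda>x. F (Complex x y)" "t * y" for y]
  by (subst (1 2) nn_integral_lborel_complex') auto

lemma nn_integral_lborel_complex_shear_Im:
  fixes F :: "complex \<Rightarrow> ennreal"
  assumes [measurable]: "F \<in> borel_measurable borel"
  shows "(\<integral>\<^sup>+z. F (Complex (Re z) (Im z + t * Re z)) \<partial>lborel) = (\<integral>\<^sup>+z. F z \<partial>lborel)"
  using nn_integral_lborel_translate[of "\<lambda>y. F (Complex x y)" "t * x" for x]
  by (subst (1 2) nn_integral_lborel_complex) auto

text \<open>A rotation of the plane, other than the identity and the half turn, is a product of three shears.\<close>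

lemma nn_integral_lborel_complex_rotate:
  fixes F :: "complex \<Rightarrow> ennreal"
  assumes F: "F \<in> borel_measurable borel" and "cmod \<zeta> = 1"
  shows "(\<integral>\<^sup>+z. F (\<zeta> * z) \<partial>lborel) = (\<integral>\<^sup>+z. F z \<partial>lborel)"
proof -
  have rot: "(\<integral>\<^sup>+z. G (\<zeta> * z) \<partial>lborel) = (\<integral>\<^sup>+z. G z \<partial>lborel)"
    if [measurable]: "G \<in> borel_measurable borel" and "cmod \<zeta> = 1" "Im \<zeta> \<noteq> 0"
    for \<zeta> and G :: "complex \<Rightarrow> ennreal"
  proof -
    \<comment> \<open>With \<open>c\<close> and \<open>s\<close> the cosine and sine of the angle,
      \<open>t\<close> is minus the tangent of half the angle, the parameter of the outer two
      shears.\<close>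
    define c s t where "c = Re \<zeta>" "s = Im \<zeta>" "t = (c - 1) / s"
    have cs: "c\<^sup>2 + s\<^sup>2 = 1" "s \<noteq> 0"
      using that by (auto simp: c_s_t_def cmod_def)
    have ts: "t * s = c - 1"
      using cs by (simp add: c_s_t_def(3))
    \<comment> \<open>The product of the three shears has the entry
      \<open>t * (2 + t * s) = t * (c + 1)\<close>, which must equal the entry \<open>- s\<close> of
      the rotation.\<close>
    have tc: "t * (c + 1) = - s"
    proof -
      have "s * (t * (c + 1)) = (c - 1) * (c + 1)" using ts by (metis mult.assoc mult.commute)
      also have "\<dots> = s * (- s)" using cs(1) by (simp add: power2_eq_square algebra_simps)
      finally show ?thesis using cs(2) by (metis mult_left_cancel)
    qed
    define A where "A = (\<lambda>z. Complex (Re z + t * Im z) (Im z))"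
    define B where "B = (\<lambda>z. Complex (Re z) (Im z + s * Re z))"
    have [measurable]: "A \<in> borel_measurable borel" "B \<in> borel_measurable borel"
      unfolding A_def B_def by measurable
    have A: "Complex (Re z + t * Im z) (Im z) = A z" and B: "Complex (Re z) (Im z + s * Re z) = B z" for z
      by (simp_all add: A_def B_def)
    have "\<zeta> * z = A (B (A z))" for z
    proof (rule complex_eqI)
      have "Re (A (B (A z))) = (1 + t * s) * Re z + (t * (2 + t * s)) * Im z"
        by (simp add: A_def B_def algebra_simps)
      also have "\<dots> = Re (\<zeta> * z)"
        using ts tc by (simp add: c_s_t_def(1,2) add.commute)
      finally show "Re (\<zeta> * z) = Re (A (B (A z)))" ..
      have "Im (A (B (A z))) = s * Re z + (1 + t * s) * Im z"
        by (simp add: A_def B_def algebra_simps)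
      also have "\<dots> = Im (\<zeta> * z)"
        using ts by (simp add: c_s_t_def(1,2))
      finally show "Im (\<zeta> * z) = Im (A (B (A z)))" ..
    qed
    then have "(\<integral>\<^sup>+z. G (\<zeta> * z) \<partial>lborel) = (\<integral>\<^sup>+z. G (A (B (A z))) \<partial>lborel)"
      by simp
    also have "\<dots> = (\<integral>\<^sup>+z. G (A (B z)) \<partial>lborel)"
      using nn_integral_lborel_complex_shear_Re[of "\<lambda>z. G (A (B z))" t]
      by (simp add: A)
    also have "\<dots> = (\<integral>\<^sup>+z. G (A z) \<partial>lborel)"
      using nn_integral_lborel_complex_shear_Im[of "\<lambda>z. G (A z)" s]
      by (simp add: B)
    also have "\<dots> = (\<integral>\<^sup>+z. G z \<partial>lborel)"
      using nn_integral_lborel_complex_shear_Re[of G t]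
      by (simp add: A)
    finally show ?thesis .
  qed
  show ?thesis
  proof (cases "Im \<zeta> = 0")
    case False
    then show ?thesis using rot[OF F \<open>cmod \<zeta> = 1\<close>] by simp
  next
    case True
    then have "\<zeta> = 1 \<or> \<zeta> = -1"
      using \<open>cmod \<zeta> = 1\<close> by (auto simp: cmod_def complex_eq_iff abs_if split: if_splits)
    \<comment> \<open>The half turn is the square of the quarter turn by \<open>\<i>\<close>, whose
      imaginary part is nonzero.\<close>
    moreover have "(\<integral>\<^sup>+z. F (- z) \<partial>lborel) = (\<integral>\<^sup>+z. F z \<partial>lborel)"
    proof -
      have [measurable]: "(\<lambda>z. F (\<i> * z)) \<in> borel_measurable borel"
        using F by measurable
      show ?thesis
        using rot[of "\<lambda>z. F (\<i> * z)" \<i>] rot[OF F, of \<i>] by (simp add: mult.assoc[symmetric])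
    qed
    ultimately show ?thesis by auto
  qed
qed

section \<open>Gaussian integrals and mean values of entire functions\<close>

text \<open>The Gaussian factors over the two coordinates. Each factor is a multiple of the centred
  normal density with variance \<open>1 / (2 * c)\<close>.\<close>

lemma integrable_gaussian_complex:
  fixes c :: real
  assumes "c > 0"
  shows "integrable lborel (\<lambda>z::complex. exp (- (c * (cmod z)\<^sup>2)))"
proof -
  define J where "J = (\<integral>\<^sup>+x. ennreal (exp (- (c * (x::real)\<^sup>2))) \<partial>lborel)"
  define \<sigma> where "\<sigma> = 1 / sqrt (2 * c)"
  have \<sigma>: "\<sigma> > 0" "2 * \<sigma>\<^sup>2 = 1 / c"
    using assms by (auto simp: \<sigma>_def power_divide)
  have "integrable lborel (\<lambda>x. sqrt (2 * pi * \<sigma>\<^sup>2) * normal_density 0 \<sigma> x)"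
    by (intro integrable_mult_right integrable_normal_density \<sigma>)
  also have "(\<lambda>x. sqrt (2 * pi * \<sigma>\<^sup>2) * normal_density 0 \<sigma> x) = (\<lambda>x. exp (- (c * x\<^sup>2)))"
    using \<sigma> assms by (auto simp: normal_density_def fun_eq_iff mult.commute)
  finally have "J < \<infinity>"
    by (simp add: integrable_iff_bounded J_def)
  have "(\<integral>\<^sup>+z. ennreal (exp (- (c * (cmod z)\<^sup>2))) \<partial>lborel) =
      (\<integral>\<^sup>+x. \<integral>\<^sup>+y. ennreal (exp (- (c * (x::real)\<^sup>2))) * ennreal (exp (- (c * (y::real)\<^sup>2))) \<partial>lborel \<partial>lborel)"
    by (subst nn_integral_lborel_complex)
       (auto intro!: nn_integral_cong simp: ennreal_mult'[symmetric] cmod_power2 exp_add[symmetric] algebra_simps)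
  also have "\<dots> = J * J"
    by (simp add: nn_integral_cmult nn_integral_multc J_def)
  also have "\<dots> < \<infinity>"
    using \<open>J < \<infinity>\<close> by (simp add: ennreal_mult_less_top)
  finally show ?thesis
    by (simp add: integrable_iff_bounded)
qed

text \<open>Cauchy's formula on the unit circle for the function taking \<open>\<zeta>\<close> to
  \<open>g (\<zeta> * z)\<close>; the denominator cancels against the derivative of the circle.
  Writing the circle as rotations of \<open>z\<close> prepares for the rotation invariance of area
  measure.\<close>

lemma circle_mean_value:
  assumes "g holomorphic_on UNIV"
  shows "((\<lambda>t. g (exp (2 * of_real pi * \<i> * of_real t) * z)) has_integral g 0) {0..1}"
proof -
  define h where "h = (\<lambda>\<zeta>. g (\<zeta> * z))"
  have "h holomorphic_on cball 0 1"
    unfolding h_def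
    by (rule holomorphic_on_compose_gen[OF _ assms, unfolded o_def]) (auto intro!: holomorphic_intros)
  from Cauchy_integral_circlepath_simple[OF this, of 0]
  have "((\<lambda>u. h u / u) has_contour_integral (2 * of_real pi * \<i> * h 0)) (circlepath 0 1)"
    by simp
  then have "((\<lambda>t. 2 * of_real pi * \<i> * h (exp (2 * of_real pi * \<i> * of_real t)))
      has_integral (2 * of_real pi * \<i> * h 0)) {0..1}"
    unfolding has_contour_integral_def
    by (rule has_integral_eq[rotated])
       (simp add: vector_derivative_circlepath01, simp add: circlepath)
  from has_integral_mult_right[OF this, of "1 / (2 * of_real pi * \<i>)"]
  show ?thesis by (simp add: h_def)
qed

text \<open>The nonnegative integral is used so that the order of integration can later be exchanged
  without integrability conditions.\<close>

lemma cmod_le_circle_mean: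
  assumes "g holomorphic_on UNIV"
  shows "ennreal (cmod (g 0)) \<le>
    (\<integral>\<^sup>+t\<in>{0..1}. ennreal (cmod (g (exp (2 * of_real pi * \<i> * of_real t) * z))) \<partial>lborel)"
proof -
  let ?h = "\<lambda>t::real. g (exp (2 * of_real pi * \<i> * of_real t) * z)"
  have cont: "continuous_on {0..1} ?h"
    by (rule continuous_on_compose2[OF holomorphic_on_imp_continuous_on[OF assms]])
       (auto intro!: continuous_intros)
  have int: "(\<lambda>t. cmod (?h t)) integrable_on {0..1}"
    by (intro integrable_continuous_interval continuous_intros cont)
  have "cmod (g 0) \<le> integral {0..1} (\<lambda>t. cmod (?h t))"
    using integral_norm_bound_integral[OF _ int, of ?h] circle_mean_value[OF assms, of z]
    by (auto simp: has_integral_iff)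
  also have "ennreal (integral {0..1} (\<lambda>t. cmod (?h t))) = (\<integral>\<^sup>+t\<in>{0..1}. ennreal (cmod (?h t)) \<partial>lborel)"
  proof -
    have "set_integrable lborel {0..1} (\<lambda>t. cmod (?h t))"
      by (intro borel_integrable_atLeastAtMost' continuous_intros cont)
    then have 1: "integrable lborel (\<lambda>t. indicator {0..1} t * cmod (?h t))"
      by (simp add: set_integrable_def)
    have "integral {0..1} (\<lambda>t. cmod (?h t)) = (\<integral>t. indicator {0..1} t * cmod (?h t) \<partial>lborel)"
      using set_borel_integral_eq_integral(2)[OF \<open>set_integrable lborel {0..1} (\<lambda>t. cmod (?h t))\<close>]
      by (simp add: set_lebesgue_integral_def)
    then show ?thesis
      using nn_integral_eq_integral[OF 1]
      by (simp add: indicator_mult_ennreal mult.commute)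
  qed
  finally show ?thesis by (simp add: ennreal_leI)
qed

text \<open>Multiply the circle mean inequality by the Gaussian and use its rotation invariance.\<close>

lemma gaussian_mean_value:
  assumes g: "g holomorphic_on UNIV"
  shows "ennreal (cmod (g 0)) * (\<integral>\<^sup>+z. ennreal (exp (- (c * (cmod z)\<^sup>2))) \<partial>lborel) \<le>
    (\<integral>\<^sup>+z. ennreal (cmod (g z) * exp (- (c * (cmod z)\<^sup>2))) \<partial>lborel)"
proof -
  let ?w = "\<lambda>z. exp (- (c * (cmod z)\<^sup>2))" and ?e = "\<lambda>t::real. exp (2 * of_real pi * \<i> * of_real t)"
  have [measurable]: "g \<in> borel_measurable borel"
    by (rule borel_measurable_continuous_onI[OF holomorphic_on_imp_continuous_on[OF g]])
  have e1: "cmod (?e t) = 1" for t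
    by simp
  have [measurable]: "?e \<in> borel_measurable borel"
    by (intro borel_measurable_continuous_onI continuous_intros)
  have "ennreal (cmod (g 0)) * (\<integral>\<^sup>+z. ennreal (?w z) \<partial>lborel) =
      (\<integral>\<^sup>+z. ennreal (cmod (g 0)) * ennreal (?w z) \<partial>lborel)"
    by (simp add: nn_integral_cmult)
  also have "\<dots> \<le> (\<integral>\<^sup>+z. (\<integral>\<^sup>+t\<in>{0..1}. ennreal (cmod (g (?e t * z))) \<partial>lborel) * ennreal (?w z) \<partial>lborel)"
    by (intro nn_integral_mono mult_right_mono cmod_le_circle_mean[OF g]) auto
  also have "\<dots> = (\<integral>\<^sup>+z. (\<integral>\<^sup>+t. ennreal (cmod (g (?e t * z)) * ?w (?e t * z)) * indicator {0..1} t \<partial>lborel) \<partial>lborel)"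
    by (subst nn_integral_multc[symmetric])
       (auto intro!: nn_integral_cong simp: ennreal_mult' norm_mult mult_ac)
  also have "\<dots> = (\<integral>\<^sup>+t. (\<integral>\<^sup>+z. ennreal (cmod (g (?e t * z)) * ?w (?e t * z)) * indicator {0..1} t \<partial>lborel) \<partial>lborel)"
    by (subst lborel_pair.Fubini') auto
  also have "\<dots> = (\<integral>\<^sup>+t\<in>{0..1::real}. (\<integral>\<^sup>+z. ennreal (cmod (g z) * ?w z) \<partial>lborel) \<partial>lborel)"
    using e1 by (subst nn_integral_multc)
      (auto intro!: nn_integral_cong simp: nn_integral_lborel_complex_rotate[of "\<lambda>z. ennreal (cmod (g z) * ?w z)"])
  also have "\<dots> = (\<integral>\<^sup>+z. ennreal (cmod (g z) * ?w z) \<partial>lborel)"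
    by (simp add: nn_integral_cmult)
  finally show ?thesis .
qed

section \<open>The Fock spaces as quasi-normed vector spaces\<close>

text \<open>Up to a constant factor, the Fock norm is the supremum or the Lebesgue norm of this
  weighted modulus. Pointwise estimates of it therefore serve finite and infinite exponents
  alike.\<close>

definition fock_abs :: "(complex \<Rightarrow> complex) \<Rightarrow> complex \<Rightarrow> real" where
  "fock_abs f z = cmod (f z) * exp (- ((cmod z)\<^sup>2 / 2))"

lemma fock_abs_nonneg [simp]: "0 \<le> fock_abs f z"
  by (simp add: fock_abs_def)

lemma fock_abs_scale: "fock_abs (\<lambda>z. c * f z) z = cmod c * fock_abs f z"
  by (simp add: fock_abs_def norm_mult)

lemma fock_abs_add_le: "fock_abs (\<lambda>z. f z + g z) z \<le> fock_abs f z + fock_abs g z"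
  by (simp add: fock_abs_def distrib_right[symmetric] mult_right_mono norm_triangle_ineq)

lemma fock_abs_powr:
  "cmod (f z) powr q * exp (- (q * (cmod z)\<^sup>2 / 2)) = fock_abs f z powr q"
  by (simp add: fock_abs_def powr_mult exp_powr_real mult.commute)

lemma borel_measurable_fock_abs:
  assumes "f holomorphic_on UNIV"
  shows "fock_abs f \<in> borel_measurable borel"
  unfolding fock_abs_def[abs_def]
  by (intro borel_measurable_continuous_onI continuous_intros holomorphic_on_imp_continuous_on[OF assms]) auto

lemma fock_space_top:
  "f \<in> fock_space top \<longleftrightarrow> f holomorphic_on UNIV \<and> bdd_above (range (fock_abs f))"
  by (simp add: fock_space_def fock_abs_def[abs_def])

lemma fock_space_finite:
  assumes "p \<noteq> top"
  shows "f \<in> fock_space p \<longleftrightarrow>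
    f holomorphic_on UNIV \<and> integrable lborel (\<lambda>z. fock_abs f z powr enn2real p)"
  using assms by (simp add: fock_space_def fock_abs_powr)

lemma fock_norm_top: "fock_norm top f = (SUP z. fock_abs f z)"
  by (simp add: fock_norm_def fock_abs_def[abs_def])

lemma fock_norm_finite:
  assumes "p \<noteq> top"
  shows "fock_norm p f = (enn2real p / (2 * pi) * (\<integral>z. fock_abs f z powr enn2real p \<partial>lborel))
    powr (1 / enn2real p)"
  using assms by (simp add: fock_norm_def fock_abs_powr)

lemma fock_space_holomorphic: "f \<in> fock_space p \<Longrightarrow> f holomorphic_on UNIV"
  by (simp add: fock_space_def)

lemma one_le_enn2real:
  fixes p :: ennreal
  assumes "1 \<le> p" "p \<noteq> top"
  shows "1 \<le> enn2real p"
  using assms enn2real_mono[of 1 p] by (simp add: less_top)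

lemma fock_abs_le_fock_norm_top:
  assumes "f \<in> fock_space top"
  shows "fock_abs f z \<le> fock_norm top f"
  using assms by (auto simp: fock_space_top fock_norm_top intro: cSUP_upper)

text \<open>The sum is at most twice the maximum. Allowing every \<open>q\<close> that is at least 0
  lets the bound be used for the exponent of the space and for its reciprocal.\<close>

lemma powr_add_le:
  fixes x y q :: real
  assumes "0 \<le> x" "0 \<le> y" "0 \<le> q"
  shows "(x + y) powr q \<le> 2 powr q * (x powr q + y powr q)"
proof -
  have "(x + y) powr q \<le> (2 * max x y) powr q"
    using assms by (intro powr_mono2) auto
  also have "\<dots> = 2 powr q * max x y powr q"
    by (rule powr_mult)
  also have "\<dots> \<le> 2 powr q * (x powr q + y powr q)"
    by (intro mult_left_mono) (auto simp: max_def)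
  finally show ?thesis .
qed

lemma fock_space_scale:
  assumes "f \<in> fock_space p"
  shows "(\<lambda>z. c * f z) \<in> fock_space p"
proof (cases "p = top")
  case True
  have "fock_abs (\<lambda>z. c * f z) z \<le> cmod c * fock_norm p f" for z
    using assms True by (auto simp: fock_abs_scale intro: mult_left_mono fock_abs_le_fock_norm_top)
  then show ?thesis
    using assms True by (auto simp: fock_space_top intro!: holomorphic_intros bdd_aboveI2)
next
  case False
  then show ?thesis
    using assms by (auto simp: fock_space_finite fock_abs_scale powr_mult intro!: holomorphic_intros)
qed

lemma integrable_fock_abs_add:
  assumes "f \<in> fock_space p" "g \<in> fock_space p" "p \<noteq> top"
  shows "integrable lborel (\<lambda>z. fock_abs (\<lambda>z. f z + g z) z powr enn2real p)" (is ?int)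
    and "(\<integral>z. fock_abs (\<lambda>z. f z + g z) z powr enn2real p \<partial>lborel) \<le> 2 powr enn2real p *
      ((\<integral>z. fock_abs f z powr enn2real p \<partial>lborel) + (\<integral>z. fock_abs g z powr enn2real p \<partial>lborel))"
proof -
  let ?q = "enn2real p"
  have hol: "(\<lambda>z. f z + g z) holomorphic_on UNIV"
    using assms by (intro holomorphic_intros) (auto intro: fock_space_holomorphic)
  have le: "fock_abs (\<lambda>z. f z + g z) z powr ?q \<le> 2 powr ?q * (fock_abs f z powr ?q + fock_abs g z powr ?q)"
    for z
    by (rule order_trans[OF powr_mono2[OF _ _ fock_abs_add_le] powr_add_le]) auto
  have int: "integrable lborel (\<lambda>z. 2 powr ?q * (fock_abs f z powr ?q + fock_abs g z powr ?q))"
    using assms by (auto simp: fock_space_finite)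
  have [measurable]: "fock_abs (\<lambda>z. f z + g z) \<in> borel_measurable borel"
    by (rule borel_measurable_fock_abs[OF hol])
  show int': ?int
    by (rule Bochner_Integration.integrable_bound[OF int]) (use le in auto)
  show "(\<integral>z. fock_abs (\<lambda>z. f z + g z) z powr ?q \<partial>lborel) \<le>
      2 powr ?q * ((\<integral>z. fock_abs f z powr ?q \<partial>lborel) + (\<integral>z. fock_abs g z powr ?q \<partial>lborel))"
    using integral_mono[OF int' int le] assms by (simp add: fock_space_finite)
qed

lemma fock_space_add:
  assumes "f \<in> fock_space p" "g \<in> fock_space p"
  shows "(\<lambda>z. f z + g z) \<in> fock_space p"
proof (cases "p = top")
  case True
  have "fock_abs (\<lambda>z. f z + g z) z \<le> fock_norm p f + fock_norm p g" for z
    using order_trans[OF fock_abs_add_le add_mono[OF fock_abs_le_fock_norm_top fock_abs_le_fock_norm_top]] assms True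
    by auto
  then show ?thesis
    using assms True by (auto simp: fock_space_top intro!: holomorphic_intros bdd_aboveI2)
next
  case False
  then show ?thesis
    using integrable_fock_abs_add(1)[OF assms] assms
    by (auto simp: fock_space_finite intro!: holomorphic_intros)
qed

lemma fock_norm_nonneg:
  assumes "f \<in> fock_space p"
  shows "0 \<le> fock_norm p f"
proof (cases "p = top")
  case True
  then show ?thesis
    using order_trans[OF fock_abs_nonneg fock_abs_le_fock_norm_top[of f 0]] assms by simp
qed (simp add: fock_norm_finite)

lemma fock_norm_scale:
  assumes "f \<in> fock_space p" "1 \<le> p"
  shows "fock_norm p (\<lambda>z. c * f z) = cmod c * fock_norm p f"
proof (cases "p = top")
  case True
  have "bdd_above (range (fock_abs f))"
    using assms True by (simp add: fock_space_top)
  \<comment> \<open>Multiplication by \<open>cmod c\<close> is monotone and continuous, hence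
    commutes with the supremum; this includes \<open>c = 0\<close>.\<close>
  then have "cmod c * Sup (range (fock_abs f)) = (SUP x\<in>range (fock_abs f). cmod c * x)"
    by (intro continuous_at_Sup_mono) (auto intro!: monoI mult_left_mono continuous_intros)
  then show ?thesis
    using True by (simp add: fock_norm_top fock_abs_scale image_image)
next
  case False
  let ?q = "enn2real p"
  have q: "1 \<le> ?q"
    using one_le_enn2real assms False by simp
  have "fock_norm p (\<lambda>z. c * f z) =
      (cmod c powr ?q * (?q / (2 * pi) * (\<integral>z. fock_abs f z powr ?q \<partial>lborel))) powr (1 / ?q)"
    using False by (simp add: fock_norm_finite fock_abs_scale powr_mult mult_ac)
  also have "\<dots> = (cmod c powr ?q) powr (1 / ?q) * fock_norm p f"
    using False q by (subst powr_mult) (auto simp: fock_norm_finite)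
  also have "(cmod c powr ?q) powr (1 / ?q) = cmod c"
    using q by (simp add: powr_powr)
  finally show ?thesis .
qed

text \<open>For finite exponents one factor 2 is the root of \<open>2 powr q\<close> from adding
  inside the integral, and the other bounds the factor \<open>2 powr (1 / q)\<close> from splitting
  the root of a sum.\<close>

lemma fock_norm_add_le:
  assumes "f \<in> fock_space p" "g \<in> fock_space p" "1 \<le> p"
  shows "fock_norm p (\<lambda>z. f z + g z) \<le> 4 * (fock_norm p f + fock_norm p g)"
proof (cases "p = top")
  case True
  have "fock_abs (\<lambda>z. f z + g z) z \<le> fock_norm p f + fock_norm p g" for z
    using order_trans[OF fock_abs_add_le add_mono[OF fock_abs_le_fock_norm_top fock_abs_le_fock_norm_top]] assms True
    by auto
  then have "fock_norm p (\<lambda>z. f z + g z) \<le> fock_norm p f + fock_norm p g"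
    unfolding True fock_norm_top[of "\<lambda>z. f z + g z"] by (intro cSUP_least) auto
  then show ?thesis
    using fock_norm_nonneg[OF assms(1)] fock_norm_nonneg[OF assms(2)] by simp
next
  case False
  let ?q = "enn2real p"
  have q: "1 \<le> ?q"
    using one_le_enn2real assms False by simp
  define A where "A = ?q / (2 * pi) * (\<integral>z. fock_abs f z powr ?q \<partial>lborel)"
  define B where "B = ?q / (2 * pi) * (\<integral>z. fock_abs g z powr ?q \<partial>lborel)"
  have AB: "0 \<le> A" "0 \<le> B"
    using q by (auto simp: A_def B_def)
  have "fock_norm p (\<lambda>z. f z + g z) \<le> (2 powr ?q * (A + B)) powr (1 / ?q)"
    unfolding fock_norm_finite[OF False]
  proof (rule powr_mono2)
    have "?q / (2 * pi) * (\<integral>z. fock_abs (\<lambda>z. f z + g z) z powr ?q \<partial>lborel) \<le>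
        ?q / (2 * pi) * (2 powr ?q *
          ((\<integral>z. fock_abs f z powr ?q \<partial>lborel) + (\<integral>z. fock_abs g z powr ?q \<partial>lborel)))"
      using q by (intro mult_left_mono integrable_fock_abs_add(2) assms False) auto
    then show "?q / (2 * pi) * (\<integral>z. fock_abs (\<lambda>z. f z + g z) z powr ?q \<partial>lborel) \<le> 2 powr ?q * (A + B)"
      by (simp add: A_def B_def algebra_simps)
  qed (use q in auto)
  also have "\<dots> = (2 powr ?q) powr (1 / ?q) * (A + B) powr (1 / ?q)"
    by (rule powr_mult)
  also have "(2 powr ?q) powr (1 / ?q) = 2"
    using q by (simp add: powr_powr)
  also have "2 * (A + B) powr (1 / ?q) \<le> 2 * (2 powr (1 / ?q) * (A powr (1 / ?q) + B powr (1 / ?q)))"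
    using AB q by (intro mult_left_mono powr_add_le) auto
  also have "\<dots> \<le> 2 * (2 * (A powr (1 / ?q) + B powr (1 / ?q)))"
    using q powr_mono[of "1 / ?q" 1 2] by (intro mult_left_mono mult_right_mono) auto
  finally show ?thesis
    using False by (simp add: fock_norm_finite A_def B_def)
qed

section \<open>Translations and point evaluations\<close>

lemma cmod_add_power2: "(cmod (z + w))\<^sup>2 = (cmod z)\<^sup>2 + 2 * Re (cnj w * z) + (cmod w)\<^sup>2"
  unfolding cmod_power2 by (simp add: power2_eq_square algebra_simps)

lemma cmod_diff_power2: "(cmod (z - w))\<^sup>2 = (cmod z)\<^sup>2 - 2 * Re (cnj w * z) + (cmod w)\<^sup>2"
  using cmod_add_power2[of z "- w"] by simp

text \<open>Expanding \<open>(cmod (z + w))\<^sup>2\<close> shows which exponential compensates the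
  shift of the weight. The transformed function is entire if \<open>f\<close> is, and it carries the
  value at \<open>w\<close> to the origin, where the mean value inequality applies.\<close>

lemma fock_abs_translate:
  "fock_abs (\<lambda>z. f (z + w) * exp (- (cnj w * z) - of_real ((cmod w)\<^sup>2 / 2))) z = fock_abs f (z + w)"
proof -
  have "Re (- (cnj w * z) - of_real ((cmod w)\<^sup>2 / 2)) + - ((cmod z)\<^sup>2 / 2) = - ((cmod (z + w))\<^sup>2 / 2)"
    by (simp add: cmod_add_power2 field_simps)
  then show ?thesis
    by (simp add: fock_abs_def norm_mult exp_add[symmetric] mult.assoc del: minus_complex.simps)
qed

lemma gaussian_integral_pos:
  fixes c :: real
  assumes "c > 0"
  shows "0 < (\<integral>z. exp (- (c * (cmod z)\<^sup>2)) \<partial>lborel)"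
proof -
  have "(\<integral>z. exp (- (c * (cmod z)\<^sup>2)) \<partial>lborel) \<noteq> 0"
    using integral_nonneg_eq_0_iff_AE[OF integrable_gaussian_complex[OF assms]]
    by (auto simp: trivial_limit_def[symmetric] ae_filter_eq_bot_iff)
  moreover have "0 \<le> (\<integral>z. exp (- (c * (cmod z)\<^sup>2)) \<partial>lborel)"
    by simp
  ultimately show ?thesis by linarith
qed

text \<open>Translate \<open>w\<close> to the origin and apply the Gaussian mean value inequality
  with the weight \<open>q / 2\<close>. Estimating the modulus by 1 plus its power of order
  \<open>q\<close> splits the right side into \<open>G\<close> and the integral defining the norm.
  The bound is not homogeneous, but it is uniform in \<open>w\<close>.\<close>

lemma fock_point_evaluation_bounded_finite:
  assumes f: "f \<in> fock_space p" and "1 \<le> p" and fin: "p \<noteq> top"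
  defines "q \<equiv> enn2real p"
  defines "G \<equiv> \<integral>z. exp (- (q / 2 * (cmod z)\<^sup>2)) \<partial>lborel"
  shows "fock_abs f w * G \<le> G + (\<integral>z. fock_abs f z powr q \<partial>lborel)"
proof -
  have q: "1 \<le> q"
    using one_le_enn2real assms by simp
  define g where "g = (\<lambda>z. f (z + w) * exp (- (cnj w * z) - of_real ((cmod w)\<^sup>2 / 2)))"
  have fock_g: "fock_abs g z = fock_abs f (z + w)" for z
    unfolding g_def by (rule fock_abs_translate)
  have [measurable]: "fock_abs f \<in> borel_measurable borel"
    using f by (intro borel_measurable_fock_abs fock_space_holomorphic)
  have g: "g holomorphic_on UNIV"
    unfolding g_def
    by (intro holomorphic_intros holomorphic_on_compose_gen[OF _ fock_space_holomorphic[OF f], unfolded o_def]) auto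
  have [measurable]: "g \<in> borel_measurable borel"
    by (rule borel_measurable_continuous_onI[OF holomorphic_on_imp_continuous_on[OF g]])
  have intG: "integrable lborel (\<lambda>z::complex. exp (- (q / 2 * (cmod z)\<^sup>2)))"
    using q by (intro integrable_gaussian_complex) auto
  have G: "(\<integral>\<^sup>+z. ennreal (exp (- (q / 2 * (cmod z)\<^sup>2))) \<partial>lborel) = ennreal G"
    unfolding G_def by (rule nn_integral_eq_integral[OF intG]) auto
  have "ennreal (cmod (g 0)) * ennreal G \<le>
      (\<integral>\<^sup>+z. ennreal (cmod (g z) * exp (- (q / 2 * (cmod z)\<^sup>2))) \<partial>lborel)"
    using gaussian_mean_value[OF g, of "q / 2"] unfolding G .
  also have "\<dots> \<le> (\<integral>\<^sup>+z. ennreal (exp (- (q / 2 * (cmod z)\<^sup>2))) + ennreal (fock_abs f (z + w) powr q) \<partial>lborel)"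
  proof (intro nn_integral_mono)
    fix z
    have "cmod (g z) \<le> 1 + cmod (g z) powr q"
    proof (cases "cmod (g z) \<le> 1")
      case False
      then show ?thesis using q powr_mono[of 1 q "cmod (g z)"] by simp
    qed (simp add: add_increasing2)
    then have "cmod (g z) * exp (- (q / 2 * (cmod z)\<^sup>2)) \<le> (1 + cmod (g z) powr q) * exp (- (q / 2 * (cmod z)\<^sup>2))"
      by (intro mult_right_mono) auto
    also have "\<dots> = exp (- (q / 2 * (cmod z)\<^sup>2)) + fock_abs g z powr q"
      using fock_abs_powr[of g z q] by (simp add: distrib_right)
    finally show "ennreal (cmod (g z) * exp (- (q / 2 * (cmod z)\<^sup>2))) \<le>
        ennreal (exp (- (q / 2 * (cmod z)\<^sup>2))) + ennreal (fock_abs f (z + w) powr q)"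
      by (simp add: fock_g ennreal_plus[symmetric] ennreal_leI del: ennreal_plus)
  qed
  also have "\<dots> = ennreal G + (\<integral>\<^sup>+z. ennreal (fock_abs f (z + w) powr q) \<partial>lborel)"
    by (subst nn_integral_add) (simp_all only: G, simp_all)
  also have "(\<integral>\<^sup>+z. ennreal (fock_abs f (z + w) powr q) \<partial>lborel) = (\<integral>\<^sup>+z. ennreal (fock_abs f z powr q) \<partial>lborel)"
    by (rule nn_integral_lborel_translate[of "\<lambda>z. ennreal (fock_abs f z powr q)"]) auto
  also have "\<dots> = ennreal (\<integral>z. fock_abs f z powr q \<partial>lborel)"
    using f fin by (intro nn_integral_eq_integral) (auto simp: fock_space_finite q_def)
  finally have "ennreal (cmod (g 0) * G) \<le> ennreal (G + (\<integral>z. fock_abs f z powr q \<partial>lborel))"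
    by (simp add: ennreal_mult' ennreal_plus[symmetric] G_def del: ennreal_plus)
  then have "cmod (g 0) * G \<le> G + (\<integral>z. fock_abs f z powr q \<partial>lborel)"
    by (subst (asm) ennreal_le_iff) (auto simp: G_def)
  moreover have "cmod (g 0) = fock_abs f w"
    using fock_g[of 0] by (simp add: fock_abs_def)
  ultimately show ?thesis by simp
qed

text \<open>A bound on each norm ball, uniform in the point, takes the place of a linear estimate.
  It is applied with radius 0 to get positivity of the norm, and with a fixed radius before
  Liouville's theorem.\<close>

lemma fock_point_evaluation_bounded:
  assumes "1 \<le> p"
  obtains B where "\<And>f z. f \<in> fock_space p \<Longrightarrow> fock_norm p f \<le> A \<Longrightarrow> fock_abs f z \<le> B"
proof (cases "p = top")
  case True
  then show ?thesis
    using that[of A] fock_abs_le_fock_norm_top order_trans by blast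
next
  case False
  define q where "q = enn2real p"
  have q: "1 \<le> q"
    using one_le_enn2real assms False by (simp add: q_def)
  define G where "G = (\<integral>z. exp (- (q / 2 * (cmod z)\<^sup>2)) \<partial>lborel)"
  have "G > 0"
    using gaussian_integral_pos[of "q / 2"] q by (simp add: G_def)
  show ?thesis
  proof (rule that)
    fix f z
    assume f: "f \<in> fock_space p" and fA: "fock_norm p f \<le> A"
    define I where "I = (\<integral>z. fock_abs f z powr q \<partial>lborel)"
    have I: "0 \<le> q * I"
      using q by (simp add: I_def)
    \<comment> \<open>Undo the root in the norm to bound the integral \<open>I\<close> by a power of
      \<open>A\<close>.\<close>
    have "q / (2 * pi) * I = ((q / (2 * pi) * I) powr (1 / q)) powr q"
      unfolding powr_powr using q I by simp
    also have "\<dots> = fock_norm p f powr q"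
      by (simp add: fock_norm_finite[OF False] q_def I_def)
    also have "\<dots> \<le> A powr q"
      using fA q fock_norm_nonneg[OF f] by (intro powr_mono2) auto
    finally have "I \<le> A powr q * (2 * pi) / q"
      using q by (simp add: field_simps)
    moreover have "fock_abs f z * G \<le> G + I"
      using fock_point_evaluation_bounded_finite[OF f assms False]
      by (simp add: q_def G_def I_def)
    ultimately have "fock_abs f z * G \<le> G + A powr q * (2 * pi) / q"
      by linarith
    then show "fock_abs f z \<le> (G + A powr q * (2 * pi) / q) / G"
      using \<open>G > 0\<close> by (simp add: pos_le_divide_eq)
  qed
qed

section \<open>Test functions: powers times exponentials, and kernels\<close>

text \<open>A Gaussian majorant belongs to every Lebesgue space. The rate 1/4, half of the natural
  rate 1/2, leaves room to absorb a polynomial factor.\<close>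

lemma fock_spaceI_gaussian:
  assumes hol: "f holomorphic_on UNIV" and "1 \<le> p"
    and le: "\<And>z. fock_abs f z \<le> C * exp (- ((cmod (z - w))\<^sup>2 / 4))"
  shows "f \<in> fock_space p"
proof -
  have "0 \<le> C * exp (- ((cmod (0 - w))\<^sup>2 / 4))"
    using order_trans[OF fock_abs_nonneg le] .
  then have C: "0 \<le> C"
    by (simp add: zero_le_mult_iff)
  show ?thesis
  proof (cases "p = top")
    case True
    have "fock_abs f z \<le> C" for z
      using order_trans[OF le mult_left_mono[OF _ C, of _ 1]] by simp
    then show ?thesis
      using hol True by (auto simp: fock_space_top intro!: bdd_aboveI2)
  next
    case False
    define q where "q = enn2real p"
    have q: "1 \<le> q"
      using one_le_enn2real assms False by (simp add: q_def)
    have [measurable]: "fock_abs f \<in> borel_measurable borel"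
      by (rule borel_measurable_fock_abs[OF hol])
    have "(\<integral>\<^sup>+z. ennreal (exp (- (q / 4 * (cmod (z + - w))\<^sup>2))) \<partial>lborel) =
        (\<integral>\<^sup>+z. ennreal (exp (- (q / 4 * (cmod z)\<^sup>2))) \<partial>lborel)"
      by (rule nn_integral_lborel_translate) auto
    also have "\<dots> < \<infinity>"
      using integrable_gaussian_complex[of "q / 4"] q by (simp add: integrable_iff_bounded)
    finally have "integrable lborel (\<lambda>z. exp (- (q / 4 * (cmod (z - w))\<^sup>2)))"
      by (simp add: integrable_iff_bounded)
    then have int: "integrable lborel (\<lambda>z. C powr q * exp (- (q / 4 * (cmod (z - w))\<^sup>2)))"
      by simp
    have "fock_abs f z powr q \<le> C powr q * exp (- (q / 4 * (cmod (z - w))\<^sup>2))" for z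
    proof -
      have "fock_abs f z powr q \<le> (C * exp (- ((cmod (z - w))\<^sup>2 / 4))) powr q"
        using q by (intro powr_mono2 le) auto
      also have "\<dots> = C powr q * exp (- (q / 4 * (cmod (z - w))\<^sup>2))"
        using C by (simp add: powr_mult exp_powr_real mult_ac)
      finally show ?thesis .
    qed
    then have "integrable lborel (\<lambda>z. fock_abs f z powr q)"
      by (intro Bochner_Integration.integrable_bound[OF int]) auto
    then show ?thesis
      using hol False by (simp add: fock_space_finite q_def)
  qed
qed

text \<open>One term of the exponential series gives \<open>r ^ k / fact k \<le> exp r\<close>, and
  \<open>r \<le> 1 + r\<^sup>2 / 4\<close> because \<open>(r / 2 - 1)\<^sup>2\<close> is
  nonnegative.\<close>

lemma power_le_exp_square:
  fixes r :: real
  assumes "0 \<le> r"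
  shows "r ^ k \<le> fact k * exp 1 * exp (r\<^sup>2 / 4)"
proof -
  have "r ^ k / fact k \<le> exp r"
    using sum_le_suminf[OF summable_exp_generic[of r], of "{k}"] assms
    by (simp add: exp_def scaleR_conv_of_real field_simps)
  also have "\<dots> \<le> exp (1 + r\<^sup>2 / 4)"
    using zero_le_power2[of "r / 2 - 1"] by (simp add: power2_eq_square algebra_simps)
  also have "\<dots> = exp 1 * exp (r\<^sup>2 / 4)"
    by (rule exp_add)
  finally show ?thesis
    by (simp add: field_simps)
qed

text \<open>Completing the square: the factor \<open>exp (cnj w * z)\<close> recentres the Gaussian
  weight at \<open>w\<close>, up to a constant.\<close>

lemma fock_abs_power_times_exp:
  "fock_abs (\<lambda>z. (z - w) ^ k * exp (cnj w * z)) z =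
    exp ((cmod w)\<^sup>2 / 2) * (cmod (z - w) ^ k * exp (- ((cmod (z - w))\<^sup>2 / 2)))"
proof -
  have "Re (cnj w * z) - (cmod z)\<^sup>2 / 2 = (cmod w)\<^sup>2 / 2 - (cmod (z - w))\<^sup>2 / 2"
    unfolding cmod_diff_power2 by (simp add: field_simps)
  then have "exp (Re (cnj w * z)) * exp (- ((cmod z)\<^sup>2 / 2)) =
      exp ((cmod w)\<^sup>2 / 2) * exp (- ((cmod (z - w))\<^sup>2 / 2))"
    by (simp add: exp_add[symmetric] del: times_complex.simps)
  then show ?thesis
    by (simp add: fock_abs_def norm_mult norm_power mult_ac del: times_complex.simps)
qed

lemma power_times_exp_in_fock_space:
  assumes "1 \<le> p"
  shows "(\<lambda>z. (z - w) ^ k * exp (cnj w * z)) \<in> fock_space p"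
proof (rule fock_spaceI_gaussian[OF _ assms])
  show "(\<lambda>z. (z - w) ^ k * exp (cnj w * z)) holomorphic_on UNIV"
    by (intro holomorphic_intros)
  fix z
  let ?r = "cmod (z - w)"
  have "?r ^ k * exp (- (?r\<^sup>2 / 2)) \<le> fact k * exp 1 * exp (?r\<^sup>2 / 4) * exp (- (?r\<^sup>2 / 2))"
    by (intro mult_right_mono power_le_exp_square) auto
  also have "\<dots> = fact k * exp 1 * exp (- (?r\<^sup>2 / 4))"
    by (simp add: mult.assoc exp_add[symmetric])
  finally show "fock_abs (\<lambda>z. (z - w) ^ k * exp (cnj w * z)) z \<le>
      exp ((cmod w)\<^sup>2 / 2) * (fact k * exp 1) * exp (- (?r\<^sup>2 / 4))"
    by (simp add: fock_abs_power_times_exp mult.assoc)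
qed

text \<open>The reproducing kernel of the Hilbert space case at \<open>w\<close>, scaled so that its
  weighted modulus is a Gaussian with peak value 1 at \<open>w\<close>.\<close>

definition fock_kernel :: "complex \<Rightarrow> complex \<Rightarrow> complex" where
  "fock_kernel w z = of_real (exp (- ((cmod w)\<^sup>2 / 2))) * exp (cnj w * z)"

lemma fock_abs_kernel: "fock_abs (fock_kernel w) z = exp (- ((cmod (z - w))\<^sup>2 / 2))"
  using fock_abs_power_times_exp[of w 0 z]
  unfolding fock_kernel_def[abs_def] fock_abs_scale
  by (simp add: mult.assoc[symmetric] exp_add[symmetric])

lemma fock_kernel_in_fock_space: "1 \<le> p \<Longrightarrow> fock_kernel w \<in> fock_space p"
  using fock_space_scale[OF power_times_exp_in_fock_space[of p w 0]]
  by (simp add: fock_kernel_def[abs_def])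

text \<open>The point is uniformity in \<open>w\<close>. For finite exponents translation invariance
  gives equality with the norm at 0; for the infinite exponent the Gaussian is at most 1, whence the
  maximum.\<close>

lemma fock_norm_kernel:
  assumes "1 \<le> p"
  shows "fock_norm p (fock_kernel w) \<le> max 1 (fock_norm p (fock_kernel 0))"
proof (cases "p = top")
  case True
  then show ?thesis
    by (simp add: fock_norm_top fock_abs_kernel le_max_iff_disj cSUP_least)
next
  case False
  define q where "q = enn2real p"
  have "(\<integral>z. exp (- ((cmod z)\<^sup>2 / 2)) powr q \<partial>lborel) =
      (\<integral>z. exp (- ((cmod z)\<^sup>2 / 2)) powr q \<partial>(distr lborel borel ((+) (- w))))"
    by (simp add: lborel_distr_plus)
  also have "\<dots> = (\<integral>z. exp (- ((cmod (z - w))\<^sup>2 / 2)) powr q \<partial>lborel)"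
    by (subst integral_distr) auto
  finally have "fock_norm p (fock_kernel w) = fock_norm p (fock_kernel 0)"
    using False by (simp add: fock_norm_finite fock_abs_kernel q_def)
  then show ?thesis by simp
qed

section \<open>Powers of unimodular numbers and their means\<close>

text \<open>By compactness of the circle two different powers of \<open>a\<close> are closer than
  \<open>\<delta>\<close>; dividing one by the other keeps the distance.\<close>

lemma exists_power_near_one:
  fixes a :: complex
  assumes "cmod a = 1" "0 < \<delta>"
  shows "\<exists>k>0. cmod (a ^ k - 1) < \<delta>"
proof -
  have "seq_compact (sphere (0::complex) 1)"
    by (simp add: compact_imp_seq_compact)
  then obtain l r where "strict_mono (r :: nat \<Rightarrow> nat)" and "((\<lambda>n. a ^ n) \<circ> r) \<longlonglongrightarrow> l"
    by (rule seq_compactE[where f = "\<lambda>n. a ^ n"]) (auto simp: norm_power assms(1))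
  then have "Cauchy ((\<lambda>n. a ^ n) \<circ> r)"
    by (intro LIMSEQ_imp_Cauchy)
  then obtain N where N: "dist (a ^ r (Suc N)) (a ^ r N) < \<delta>"
    using \<open>0 < \<delta>\<close> unfolding Cauchy_def o_def by (meson le_refl le_SucI)
  have less: "r N < r (Suc N)"
    using \<open>strict_mono r\<close> by (simp add: strict_mono_Suc_iff)
  have "a ^ r (Suc N) - a ^ r N = a ^ r N * (a ^ (r (Suc N) - r N) - 1)"
    using less by (simp add: algebra_simps flip: power_add)
  then have "cmod (a ^ (r (Suc N) - r N) - 1) < \<delta>"
    using N by (simp add: dist_norm norm_mult norm_power assms(1))
  then show ?thesis
    using less zero_less_diff by blast
qed

lemma cmod_power_minus_one_le:
  fixes a :: complex
  assumes "cmod a = 1"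
  shows "cmod (a ^ m - 1) \<le> real m * cmod (a - 1)"
proof (induction m)
  case (Suc m)
  have "a ^ Suc m - 1 = a * (a ^ m - 1) + (a - 1)"
    by (simp add: algebra_simps)
  then have "cmod (a ^ Suc m - 1) \<le> cmod (a ^ m - 1) + cmod (a - 1)"
    using norm_triangle_ineq[of "a * (a ^ m - 1)" "a - 1"] assms by (simp only: norm_mult mult_1)
  then show ?case
    using Suc by (simp add: algebra_simps)
qed simp

text \<open>The eigenvalue of the Cesaro mean of order \<open>n\<close> at an eigenvector with
  eigenvalue \<open>r\<close>.\<close>

definition power_mean :: "complex \<Rightarrow> nat \<Rightarrow> complex" where
  "power_mean r n = (\<Sum>m=1..n. r ^ m) / of_nat n"

text \<open>The geometric sums stay bounded by \<open>2 / cmod (1 - r)\<close>, so dividing by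
  \<open>n\<close> sends them to 0. The rate degenerates as \<open>r\<close> approaches 1.\<close>

lemma power_mean_tendsto_0:
  assumes "cmod r = 1" "r \<noteq> 1"
  shows "power_mean r \<longlonglongrightarrow> 0"
proof (rule Lim_null_comparison)
  show "\<forall>\<^sub>F n in sequentially. norm (power_mean r n) \<le> (2 / cmod (1 - r)) * inverse (real n)"
  proof (intro always_eventually allI)
    fix n
    have "(\<Sum>m=1..n. r ^ m) = r * (\<Sum>m<n. r ^ m)"
      unfolding sum_distrib_left
      by (rule sum.reindex_bij_witness[of _ Suc "\<lambda>m. m - 1"]) (auto simp flip: power_Suc)
    also have "(\<Sum>m<n. r ^ m) = (1 - r ^ n) / (1 - r)"
      using assms(2) by (simp add: sum_gp_strict)
    finally have "cmod (\<Sum>m=1..n. r ^ m) = cmod (1 - r ^ n) / cmod (1 - r)"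
      using assms(1) by (simp add: norm_mult norm_divide)
    also have "\<dots> \<le> 2 / cmod (1 - r)"
      using norm_triangle_ineq4[of 1 "r ^ n"] assms(1) by (intro divide_right_mono) (auto simp: norm_power)
    finally show "norm (power_mean r n) \<le> (2 / cmod (1 - r)) * inverse (real n)"
      unfolding power_mean_def norm_divide norm_of_nat divide_inverse[of _ "real n"]
      by (rule mult_right_mono) simp
  qed
  show "(\<lambda>n. 2 / cmod (1 - r) * inverse (real n)) \<longlonglongrightarrow> 0"
    by (rule tendsto_mult_right_zero[OF lim_inverse_n])
qed

text \<open>For given \<open>n\<close>, choose \<open>k\<close> with \<open>a ^ k\<close> within
  \<open>1 / (2 * n)\<close> of 1. Its first \<open>n\<close> powers, hence also their mean, then
  stay within 1/2 of 1. The choice of \<open>k\<close> depends on \<open>n\<close>, which is how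
  uniform convergence fails.\<close>

lemma exists_power_mean_ge_half:
  assumes "cmod a = 1" "n > 0"
  shows "\<exists>k>0. 1 / 2 \<le> cmod (power_mean (a ^ k) n)"
proof -
  obtain k where k: "k > 0" "cmod (a ^ k - 1) < 1 / (2 * real n)"
    using exists_power_near_one[OF assms(1), of "1 / (2 * real n)"] assms(2) by auto
  have "cmod ((a ^ k) ^ m - 1) \<le> 1 / 2" if "m \<in> {1..n}" for m
  proof -
    have "cmod ((a ^ k) ^ m - 1) \<le> real m * cmod (a ^ k - 1)"
      using assms(1) by (intro cmod_power_minus_one_le) (simp add: norm_power)
    also have "\<dots> \<le> real n * (1 / (2 * real n))"
      using that k by (intro mult_mono) auto
    finally show ?thesis using assms(2) by simp
  qed
  then have "cmod (\<Sum>m=1..n. (a ^ k) ^ m - 1) \<le> real n * (1 / 2)"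
    using sum_norm_le[of "{1..n}" "\<lambda>m. (a ^ k) ^ m - 1" "\<lambda>_. 1 / 2"] by simp
  moreover have "power_mean (a ^ k) n - 1 = (\<Sum>m=1..n. (a ^ k) ^ m - 1) / of_nat n"
    using assms(2) by (simp add: power_mean_def sum_subtractf diff_divide_distrib)
  ultimately have "cmod (power_mean (a ^ k) n - 1) \<le> 1 / 2"
    using assms(2) by (simp add: norm_divide pos_divide_le_eq)
  moreover have "1 \<le> cmod (power_mean (a ^ k) n) + cmod (power_mean (a ^ k) n - 1)"
    using norm_triangle_ineq4[of "power_mean (a ^ k) n" "power_mean (a ^ k) n - 1"] by simp
  ultimately show ?thesis using k(1) by (intro exI[of _ k]) auto
qed

section \<open>Mean ergodicity on quasi-normed function spaces\<close>

locale quasi_normed_function_space =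
  fixes X :: "('a \<Rightarrow> complex) set" and N :: "('a \<Rightarrow> complex) \<Rightarrow> real" and Q :: real
  assumes add_closed: "f \<in> X \<Longrightarrow> g \<in> X \<Longrightarrow> (\<lambda>z. f z + g z) \<in> X"
    and scale_closed: "f \<in> X \<Longrightarrow> (\<lambda>z. c * f z) \<in> X"
    and norm_nonneg: "f \<in> X \<Longrightarrow> 0 \<le> N f"
    and norm_scale: "f \<in> X \<Longrightarrow> N (\<lambda>z. c * f z) = cmod c * N f"
    and quasi_triangle: "f \<in> X \<Longrightarrow> g \<in> X \<Longrightarrow> N (\<lambda>z. f z + g z) \<le> Q * (N f + N g)"
    and Q_nonneg: "0 \<le> Q"
begin

text \<open>Boundedness without linearity, closed under the operations that build Cesaro means. It
  ensures that the supremum in \<open>operator_norm\<close> is over a set bounded above; a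
  nonnegative \<open>B\<close> lets bounds be multiplied.\<close>

definition bounded_map :: "(('a \<Rightarrow> complex) \<Rightarrow> ('a \<Rightarrow> complex)) \<Rightarrow> bool" where
  "bounded_map T \<longleftrightarrow> (\<forall>f\<in>X. T f \<in> X) \<and> (\<exists>B\<ge>0. \<forall>f\<in>X. N (T f) \<le> B * N f)"

lemma bounded_operator_imp_bounded_map:
  assumes "bounded_operator X N T"
  shows "bounded_map T"
proof -
  obtain C where C: "\<And>f. f \<in> X \<Longrightarrow> N (T f) \<le> C * N f"
    using assms unfolding bounded_operator_def by blast
  \<comment> \<open>The constant in \<open>bounded_operator\<close> may be negative.\<close>
  have "N (T f) \<le> max C 0 * N f" if "f \<in> X" for f
    using C[OF that] mult_right_mono[OF max.cobounded1[of C 0] norm_nonneg[OF that]] by linarith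
  then show ?thesis
    using assms unfolding bounded_map_def bounded_operator_def by (meson max.cobounded2)
qed

lemma bounded_map_compose:
  assumes "bounded_map S" "bounded_map T"
  shows "bounded_map (\<lambda>f. S (T f))"
proof -
  obtain B C where BC: "0 \<le> B" "0 \<le> C" "\<And>f. f \<in> X \<Longrightarrow> N (S f) \<le> B * N f" "\<And>f. f \<in> X \<Longrightarrow> N (T f) \<le> C * N f"
    using assms by (auto simp: bounded_map_def)
  have "N (S (T f)) \<le> B * C * N f" if "f \<in> X" for f
    using BC(3)[of "T f"] mult_left_mono[OF BC(4)[OF that] BC(1)] assms that
    by (force simp: bounded_map_def mult.assoc)
  then show ?thesis
    using assms BC(1,2) unfolding bounded_map_def by (meson mult_nonneg_nonneg)
qed

lemma bounded_map_power: "bounded_map T \<Longrightarrow> bounded_map (T ^^ m)"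
proof (induction m)
  case 0
  then show ?case by (auto simp: bounded_map_def intro!: exI[of _ 1])
next
  case (Suc m)
  then show ?case using bounded_map_compose[of T "T ^^ m"] by (simp add: o_def)
qed

lemma bounded_map_scale:
  assumes "bounded_map T"
  shows "bounded_map (\<lambda>f z. c * T f z)"
proof -
  obtain B where B: "0 \<le> B" "\<And>f. f \<in> X \<Longrightarrow> N (T f) \<le> B * N f"
    using assms by (auto simp: bounded_map_def)
  have "N (\<lambda>z. c * T f z) \<le> cmod c * B * N f" if "f \<in> X" for f
    using mult_left_mono[OF B(2)[OF that], of "cmod c"] assms that
    by (simp add: norm_scale bounded_map_def mult.assoc)
  then show ?thesis
    using assms B(1) scale_closed unfolding bounded_map_def by (meson mult_nonneg_nonneg norm_ge_zero)
qed

lemma bounded_map_add: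
  assumes "bounded_map S" "bounded_map T"
  shows "bounded_map (\<lambda>f z. S f z + T f z)"
proof -
  obtain B C where BC: "0 \<le> B" "0 \<le> C" "\<And>f. f \<in> X \<Longrightarrow> N (S f) \<le> B * N f" "\<And>f. f \<in> X \<Longrightarrow> N (T f) \<le> C * N f"
    using assms by (auto simp: bounded_map_def)
  have "N (\<lambda>z. S f z + T f z) \<le> Q * (B + C) * N f" if "f \<in> X" for f
  proof -
    have "N (\<lambda>z. S f z + T f z) \<le> Q * (N (S f) + N (T f))"
      using assms that by (intro quasi_triangle) (auto simp: bounded_map_def)
    also have "\<dots> \<le> Q * (B * N f + C * N f)"
      using that by (intro mult_left_mono add_mono BC Q_nonneg)
    finally show ?thesis by (simp add: algebra_simps)
  qed
  then show ?thesis
    using assms BC(1,2) Q_nonneg add_closed unfolding bounded_map_def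
    by (meson mult_nonneg_nonneg add_nonneg_nonneg)
qed

lemma bounded_map_sum_powers:
  assumes "bounded_map T"
  shows "bounded_map (\<lambda>f z. \<Sum>m=1..n. (T ^^ m) f z)"
proof (induction n)
  case 0
  \<comment> \<open>The empty sum is the zero map, here the multiple of \<open>T\<close> by
    0.\<close>
  then show ?case using bounded_map_scale[OF assms, of 0] by simp
next
  case (Suc n)
  then show ?case using bounded_map_add[OF Suc bounded_map_power[OF assms, of "Suc n"]] by simp
qed

lemma bounded_map_cesaro_mean_diff:
  assumes "bounded_map T" "bounded_map P"
  shows "bounded_map (\<lambda>f z. cesaro_mean T n f z - P f z)"
  using bounded_map_add[OF bounded_map_scale[OF bounded_map_sum_powers[OF assms(1)], of "1 / of_nat n"]
      bounded_map_scale[OF assms(2), of "-1"]]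
  by (simp add: cesaro_mean_def)

lemma norm_le_operator_norm:
  assumes "bounded_map T" "f \<in> X" "N f \<le> 1"
  shows "N (T f) \<le> operator_norm X N T"
proof -
  obtain B where B: "0 \<le> B" "\<And>f. f \<in> X \<Longrightarrow> N (T f) \<le> B * N f"
    using assms by (auto simp: bounded_map_def)
  have "N (T g) \<le> B" if "g \<in> X" "N g \<le> 1" for g
    using order_trans[OF B(2)[OF that(1)] mult_left_mono[OF that(2) B(1)]] by simp
  then have "bdd_above ((\<lambda>f. N (T f)) ` {f \<in> X. N f \<le> 1})"
    by (intro bdd_aboveI2[of _ _ B]) auto
  then show ?thesis
    unfolding operator_norm_def using assms by (intro cSUP_upper) auto
qed

lemma cesaro_mean_eigenvector:
  assumes "bounded_operator X N T" "e \<in> X" "T e = (\<lambda>z. r * e z)"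
  shows "cesaro_mean T n e = (\<lambda>z. power_mean r n * e z)"
proof -
  have "(T ^^ m) e = (\<lambda>z. r ^ m * e z)" for m
  proof (induction m)
    case (Suc m)
    have "(T ^^ Suc m) e = T (\<lambda>z. r ^ m * e z)"
      by (simp add: Suc)
    also have "\<dots> = (\<lambda>z. r ^ m * T e z)"
      using assms by (auto simp: bounded_operator_def)
    finally show ?case
      by (simp add: assms(3) mult_ac)
  qed simp
  then show ?thesis
    by (simp add: cesaro_mean_def power_mean_def sum_distrib_right)
qed

text \<open>
  The limit projection must annihilate an eigenvector with unimodular eigenvalue \<open>r \<noteq> 1\<close>, so the
  error at such an eigenvector is the whole Cesaro mean of the powers of \<open>r\<close>.
\<close>

lemma power_mean_le_operator_norm:
  assumes T: "bounded_operator X N T" and P: "bounded_operator X N P"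
    and lim: "(\<lambda>n. operator_norm X N (\<lambda>f z. cesaro_mean T n f z - P f z)) \<longlonglongrightarrow> 0"
    and e: "e \<in> X" "N e = 1" "T e = (\<lambda>z. r * e z)" and r: "cmod r = 1" "r \<noteq> 1"
  shows "cmod (power_mean r n) \<le> Q * operator_norm X N (\<lambda>f z. cesaro_mean T n f z - P f z)"
proof -
  define D where "D = (\<lambda>n f z. cesaro_mean T n f z - P f z)"
  define \<epsilon> where "\<epsilon> = (\<lambda>n. operator_norm X N (D n))"
  have D: "bounded_map (D n)" for n
    unfolding D_def by (intro bounded_map_cesaro_mean_diff bounded_operator_imp_bounded_map T P)
  have DX: "D n e \<in> X" and PX: "P e \<in> X" for n
    using D e(1) P by (auto simp: bounded_map_def bounded_operator_def)
  have D_le: "N (D n e) \<le> \<epsilon> n" for n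
    unfolding \<epsilon>_def using e by (intro norm_le_operator_norm D) auto
  have De: "D n e = (\<lambda>z. power_mean r n * e z - P e z)" for n
    by (simp add: D_def cesaro_mean_eigenvector[OF T e(1,3)])
  \<comment> \<open>The left side does not depend on \<open>n\<close>, so letting \<open>n\<close>
    tend to infinity forces it to 0.\<close>
  have "N (P e) \<le> Q * (cmod (power_mean r n) + \<epsilon> n)" for n
  proof -
    have "P e = (\<lambda>z. power_mean r n * e z + (-1) * D n e z)"
      by (simp add: De)
    then have "N (P e) \<le> Q * (N (\<lambda>z. power_mean r n * e z) + N (\<lambda>z. (-1) * D n e z))"
      using quasi_triangle[OF scale_closed[OF e(1)] scale_closed[OF DX]] by metis
    also have "\<dots> = Q * (cmod (power_mean r n) + N (D n e))"
      using norm_scale[OF e(1)] norm_scale[OF DX, of "-1"] e(2) by simp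
    also have "\<dots> \<le> Q * (cmod (power_mean r n) + \<epsilon> n)"
      using D_le Q_nonneg by (intro mult_left_mono) auto
    finally show ?thesis .
  qed
  moreover have "(\<lambda>n. Q * (cmod (power_mean r n) + \<epsilon> n)) \<longlonglongrightarrow> Q * (0 + 0)"
    using lim unfolding \<epsilon>_def D_def
    by (intro tendsto_intros tendsto_norm_zero power_mean_tendsto_0 r)
  ultimately have "N (P e) \<le> Q * (0 + 0)"
    by (intro LIMSEQ_le_const) auto
  \<comment> \<open>The locale does not make \<open>N\<close> definite, so this gives
    \<open>N (P e) = 0\<close> and not \<open>P e = 0\<close>; the next estimate works with the norm
    alone.\<close>
  then have Pe: "N (P e) = 0"
    using norm_nonneg[OF PX] by simp
  have "cmod (power_mean r n) = N (\<lambda>z. D n e z + P e z)"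
    by (simp add: De norm_scale[OF e(1)] e(2))
  also have "\<dots> \<le> Q * (N (D n e) + N (P e))"
    by (rule quasi_triangle[OF DX PX])
  also have "\<dots> \<le> Q * \<epsilon> n"
    using D_le[of n] Q_nonneg by (simp add: Pe mult_left_mono)
  finally show ?thesis
    by (simp add: \<epsilon>_def D_def)
qed

text \<open>Norm convergence would make the means of the powers of \<open>a ^ k\<close> small for
  one \<open>n\<close> and all positive \<open>k\<close> at once. Fixing that \<open>n\<close> first
  and choosing \<open>k\<close> afterwards gives a mean of modulus at least 1/2.\<close>

lemma not_uniformly_mean_ergodic:
  assumes a: "cmod a = 1" "\<And>n::nat. n > 0 \<Longrightarrow> a ^ n \<noteq> 1"
    and e: "\<And>k. e k \<in> X" "\<And>k. 0 < N (e k)" "\<And>k. T (e k) = (\<lambda>z. a ^ k * e k z)"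
  shows "\<not> uniformly_mean_ergodic X N T"
proof
  assume "uniformly_mean_ergodic X N T"
  then obtain P where T: "bounded_operator X N T" and P: "bounded_operator X N P"
    and lim: "(\<lambda>n. operator_norm X N (\<lambda>f z. cesaro_mean T n f z - P f z)) \<longlonglongrightarrow> 0"
    by (auto simp: uniformly_mean_ergodic_def)
  define \<epsilon> where "\<epsilon> = (\<lambda>n. operator_norm X N (\<lambda>f z. cesaro_mean T n f z - P f z))"
  have bound: "cmod (power_mean (a ^ k) n) \<le> Q * \<epsilon> n" if "k > 0" for k n
    unfolding \<epsilon>_def
  proof (rule power_mean_le_operator_norm[OF T P lim])
    let ?e = "\<lambda>z. of_real (1 / N (e k)) * e k z"
    show "?e \<in> X"
      by (intro scale_closed e)
    show "N ?e = 1"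
      using e(2)[of k] by (subst norm_scale[OF e(1)]) (simp add: norm_divide)
    have "T ?e = (\<lambda>z. of_real (1 / N (e k)) * T (e k) z)"
      using T e(1) unfolding bounded_operator_def by blast
    then show "T ?e = (\<lambda>z. a ^ k * ?e z)"
      by (simp add: e(3) mult_ac)
  qed (use a that in \<open>auto simp: norm_power\<close>)
  have "(\<lambda>n. Q * \<epsilon> n) \<longlonglongrightarrow> 0"
    using tendsto_mult_right_zero[OF lim, of Q] by (simp add: \<epsilon>_def)
  then have "\<forall>\<^sub>F n in sequentially. Q * \<epsilon> n < 1 / 2"
    by (rule order_tendstoD) simp
  \<comment> \<open>Positivity of \<open>n\<close> matters: the mean of order 0 is 0 by the
    convention for division by zero.\<close>
  then obtain n where n: "n > 0" "Q * \<epsilon> n < 1 / 2"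
    using eventually_conj[OF _ eventually_gt_at_top[of 0], THEN eventually_happens] by auto
  obtain k where "k > 0" "1 / 2 \<le> cmod (power_mean (a ^ k) n)"
    using exists_power_mean_ge_half[OF a(1) n(1)] by auto
  then show False
    using bound[of k n] n(2) by simp
qed

end

section \<open>The weighted composition operator on Fock space\<close>

lemma quasi_normed_fock_space:
  assumes "1 \<le> p"
  shows "quasi_normed_function_space (fock_space p) (fock_norm p) 4"
  by (standard; (intro fock_space_add fock_space_scale fock_norm_nonneg fock_norm_scale fock_norm_add_le assms)?) simp_all

text \<open>If the norm were 0, all multiples of \<open>f\<close> would lie in the ball of radius 0,
  where point evaluations are bounded; but the values of the multiples at \<open>z\<close> are
  unbounded.\<close>

lemma fock_norm_pos:
  assumes f: "f \<in> fock_space p" and "1 \<le> p" and "f z \<noteq> 0"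
  shows "0 < fock_norm p f"
proof (rule ccontr)
  assume "\<not> 0 < fock_norm p f"
  then have 0: "fock_norm p f = 0"
    using fock_norm_nonneg[OF f] by simp
  obtain B where B: "\<And>g z. g \<in> fock_space p \<Longrightarrow> fock_norm p g \<le> 0 \<Longrightarrow> fock_abs g z \<le> B"
    using fock_point_evaluation_bounded[OF \<open>1 \<le> p\<close>] by blast
  have pos: "0 < fock_abs f z"
    using \<open>f z \<noteq> 0\<close> by (simp add: fock_abs_def)
  \<comment> \<open>Scaling by \<open>t\<close> makes the weighted modulus at \<open>z\<close> equal
    to \<open>\<bar>B\<bar> + 1\<close>, which exceeds \<open>B\<close>.\<close>
  define t where "t = (\<bar>B\<bar> + 1) / fock_abs f z"
  have "fock_abs (\<lambda>z. of_real t * f z) z \<le> B"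
    using 0 by (intro B fock_space_scale f) (simp add: fock_norm_scale[OF f \<open>1 \<le> p\<close>])
  then show False
    using pos unfolding fock_abs_scale norm_of_real by (simp add: t_def)
qed

text \<open>Testing \<open>W\<close> on the kernel at \<open>\<psi> z\<close> bounds \<open>u z * exp (a * cnj b * z)\<close>, and Liouville applies.\<close>

lemma weighted_comp_symbol:
  assumes "1 \<le> p" and u: "u holomorphic_on UNIV"
    and W: "bounded_operator (fock_space p) (fock_norm p) (weighted_comp u \<psi>)"
    and \<psi>: "\<And>z. \<psi> z = a * z + b" and a: "cmod a = 1"
  shows "u z = u 0 * exp (- (a * cnj b * z))"
proof -
  let ?h = "\<lambda>z. u z * exp (a * cnj b * z)"
  obtain C where C: "\<And>f. f \<in> fock_space p \<Longrightarrow> fock_norm p (weighted_comp u \<psi> f) \<le> C * fock_norm p f"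
    using W unfolding bounded_operator_def by blast
  define A where "A = \<bar>C\<bar> * max 1 (fock_norm p (fock_kernel 0))"
  obtain B where B: "\<And>f z. f \<in> fock_space p \<Longrightarrow> fock_norm p f \<le> A \<Longrightarrow> fock_abs f z \<le> B"
    using fock_point_evaluation_bounded[OF \<open>1 \<le> p\<close>] by blast
  have "cmod (?h z) \<le> B" for z
  proof -
    let ?k = "fock_kernel (\<psi> z)"
    have k: "?k \<in> fock_space p"
      using \<open>1 \<le> p\<close> by (rule fock_kernel_in_fock_space)
    have "fock_norm p (weighted_comp u \<psi> ?k) \<le> C * fock_norm p ?k"
      by (rule C[OF k])
    also have "\<dots> \<le> \<bar>C\<bar> * max 1 (fock_norm p (fock_kernel 0))"
      using fock_norm_nonneg[OF k] fock_norm_kernel[OF \<open>1 \<le> p\<close>] by (intro mult_mono) auto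
    finally have "fock_abs (weighted_comp u \<psi> ?k) z \<le> B"
      using W k by (intro B) (auto simp: A_def bounded_operator_def)
    \<comment> \<open>At \<open>z\<close> the operator evaluates the kernel at its own centre
      \<open>\<psi> z\<close>, where its weighted modulus is 1.\<close>
    moreover have "fock_abs (weighted_comp u \<psi> ?k) z =
        cmod (u z) * exp ((cmod (\<psi> z))\<^sup>2 / 2 - (cmod z)\<^sup>2 / 2)"
    proof -
      have "cmod (?k (\<psi> z)) = exp ((cmod (\<psi> z))\<^sup>2 / 2)"
        using fock_abs_kernel[of "\<psi> z" "\<psi> z"] by (simp add: fock_abs_def exp_minus field_simps)
      then show ?thesis
        by (simp add: fock_abs_def weighted_comp_def norm_mult mult.assoc flip: exp_add)
    qed
    \<comment> \<open>Since \<open>cmod a = 1\<close>, the quadratic terms cancel. What remains is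
      the real part of a linear function of \<open>z\<close> plus a nonnegative constant, so the
      growth factor can be replaced by a holomorphic one.\<close>
    moreover have "Re (a * cnj b * z) \<le> (cmod (\<psi> z))\<^sup>2 / 2 - (cmod z)\<^sup>2 / 2"
    proof -
      have "(cmod (\<psi> z))\<^sup>2 = (cmod z)\<^sup>2 + 2 * Re (cnj b * (a * z)) + (cmod b)\<^sup>2"
        using a by (simp only: \<psi> cmod_add_power2 norm_mult) simp
      moreover have "cnj b * (a * z) = a * cnj b * z"
        by simp
      ultimately have "(cmod (\<psi> z))\<^sup>2 = (cmod z)\<^sup>2 + 2 * Re (a * cnj b * z) + (cmod b)\<^sup>2"
        by metis
      then show ?thesis
        using zero_le_power2[of "cmod b"] by linarith
    qed
    then have "cmod (?h z) \<le> cmod (u z) * exp ((cmod (\<psi> z))\<^sup>2 / 2 - (cmod z)\<^sup>2 / 2)"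
      unfolding norm_mult norm_exp_eq_Re by (intro mult_left_mono) auto
    ultimately show ?thesis
      by linarith
  qed
  then have "bounded (range ?h)"
    by (auto simp: bounded_iff)
  moreover have "?h holomorphic_on UNIV"
    by (intro holomorphic_intros u)
  ultimately obtain c where c: "?h z = c" for z
    using Liouville_theorem[of ?h] by (auto simp: constant_on_def)
  have "u 0 = c"
    using c[of 0] by simp
  then show ?thesis
    using c[of z] by (simp add: exp_minus field_simps)
qed

text \<open>About its fixed point \<open>w\<close> the map \<open>\<psi>\<close> is the rotation by
  \<open>a\<close>, which contributes \<open>a ^ k\<close>. The exponential in \<open>u\<close>,
  normalised by \<open>u w = 1\<close>, exactly undoes the effect of \<open>\<psi>\<close> on
  \<open>exp (cnj w * z)\<close>.\<close>

lemma weighted_comp_eigenfunction: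
  assumes u: "\<And>z. u z = u 0 * exp (- (a * cnj b * z))"
    and \<psi>: "\<And>z. \<psi> z = a * z + b" and a: "cmod a = 1"
    and w: "a * w + b = w" "u w = 1"
  shows "weighted_comp u \<psi> (\<lambda>z. (z - w) ^ k * exp (cnj w * z)) = (\<lambda>z. a ^ k * ((z - w) ^ k * exp (cnj w * z)))"
proof
  fix z
  have "a * cnj a = 1"
    using a by (simp add: complex_norm_square[symmetric])
  \<comment> \<open>Conjugate the fixed point equation and multiply by \<open>a\<close>; then
    \<open>a * cnj a = 1\<close> expresses \<open>a * cnj b\<close> through
    \<open>w\<close>.\<close>
  have "cnj w - cnj b = cnj (a * w)"
    using w(1) by (metis add_diff_cancel_right' complex_cnj_diff)
  then have "a * (cnj w - cnj b) = cnj w"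
    using \<open>a * cnj a = 1\<close> by (simp add: mult.assoc[symmetric])
  then have acb: "a * cnj b = a * cnj w - cnj w"
    by (simp add: algebra_simps)
  have "u z * exp (a * cnj b * (z - w)) = u w"
    unfolding u[of z] u[of w] mult.assoc exp_add[symmetric] by (simp add: algebra_simps)
  then have uz: "u z * exp (a * cnj b * (z - w)) = 1"
    using w(2) by simp
  have diff: "a * z + b - w = a * (z - w)"
    using w(1) by (simp add: algebra_simps)
  have "cnj w * (a * z + b) = a * cnj b * (z - w) + cnj w * z"
  proof -
    have b: "b = w - a * w"
      using w(1) by (simp add: algebra_simps)
    show ?thesis
      unfolding acb by (subst b) (simp add: algebra_simps)
  qed
  then have "u z * exp (cnj w * (a * z + b)) = exp (cnj w * z)"
    using uz by (simp add: exp_add mult.assoc[symmetric])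
  then show "weighted_comp u \<psi> (\<lambda>z. (z - w) ^ k * exp (cnj w * z)) z = a ^ k * ((z - w) ^ k * exp (cnj w * z))"
    by (simp add: weighted_comp_def \<psi> diff power_mult_distrib mult_ac)
qed

text \<open>The squared modulus of \<open>1 - a\<close> is \<open>2 * (1 - Re a)\<close>, twice its
  real part. This evaluates the exponent that determines the modulus of \<open>u 0\<close>.\<close>

lemma Re_inverse_one_minus_unimodular:
  assumes "cmod a = 1" "a \<noteq> 1"
  shows "Re (1 / (1 - a)) = 1 / 2"
proof -
  have "(Re a)\<^sup>2 + (Im a)\<^sup>2 = 1"
    using assms(1) by (metis cmod_power2 one_power2)
  then have "(Re (1 - a))\<^sup>2 + (Im (1 - a))\<^sup>2 = 2 * (1 - Re a)"
    by (simp add: power2_eq_square algebra_simps)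
  moreover have "Re a \<noteq> 1"
    using \<open>(Re a)\<^sup>2 + (Im a)\<^sup>2 = 1\<close> assms(2) by (auto simp: complex_eq_iff)
  ultimately show ?thesis
    by (simp add: Re_divide)
qed

theorem corollary4p6:
  fixes p :: ennreal and u \<psi> :: "complex \<Rightarrow> complex" and a b :: complex
  assumes "1 \<le> p"
    and "u holomorphic_on UNIV" and "\<psi> holomorphic_on UNIV"
    and "bounded_operator (fock_space p) (fock_norm p) (weighted_comp u \<psi>)"
    and "\<And>z. \<psi> z = a * z + b"
    and "cmod a = 1"
    and "\<And>n::nat. n > 0 \<Longrightarrow> a ^ n \<noteq> 1"
    and "u (b / (1 - a)) = 1"
  shows "cmod (u 0) = exp (- ((cmod b)\<^sup>2 / 2)) \<and>
         \<not> uniformly_mean_ergodic (fock_space p) (fock_norm p) (weighted_comp u \<psi>)"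
proof
  define w where "w = b / (1 - a)"
  have "a \<noteq> 1"
    using assms(7)[of 1] by simp
  then have w: "a * w + b = w"
    by (simp add: w_def field_simps)
  have u: "u z = u 0 * exp (- (a * cnj b * z))" for z
    by (rule weighted_comp_symbol[OF assms(1,2,4,5,6)])
  \<comment> \<open>Insert \<open>w = b / (1 - a)\<close> and use
    \<open>a / (1 - a) = 1 / (1 - a) - 1\<close>, whose real part is -1/2.\<close>
  have "a * cnj b * w = of_real ((cmod b)\<^sup>2) * (1 / (1 - a) - 1)"
    using \<open>a \<noteq> 1\<close> unfolding complex_norm_square by (simp add: w_def field_simps)
  then have "Re (a * cnj b * w) = (cmod b)\<^sup>2 * (Re (1 / (1 - a)) - 1)"
    by simp
  also have "\<dots> = - ((cmod b)\<^sup>2 / 2)"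
    unfolding Re_inverse_one_minus_unimodular[OF assms(6) \<open>a \<noteq> 1\<close>] by simp
  finally have Re: "Re (a * cnj b * w) = - ((cmod b)\<^sup>2 / 2)" .
  have "u 0 = exp (a * cnj b * w)"
    using u[of w] assms(8) by (simp add: exp_minus field_simps flip: w_def)
  then show "cmod (u 0) = exp (- ((cmod b)\<^sup>2 / 2))"
    using Re by (simp only: norm_exp_eq_Re)
  interpret quasi_normed_function_space "fock_space p" "fock_norm p" 4
    by (rule quasi_normed_fock_space[OF assms(1)])
  show "\<not> uniformly_mean_ergodic (fock_space p) (fock_norm p) (weighted_comp u \<psi>)"
  proof (rule not_uniformly_mean_ergodic[OF assms(6,7)])
    fix k
    let ?e = "\<lambda>z. (z - w) ^ k * exp (cnj w * z)"
    show e: "?e \<in> fock_space p"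
      by (rule power_times_exp_in_fock_space[OF assms(1)])
    show "0 < fock_norm p ?e"
      \<comment> \<open>At \<open>w\<close> the function vanishes for positive \<open>k\<close>; at
        \<open>w + 1\<close> the power is 1 for every \<open>k\<close>.\<close>
      by (rule fock_norm_pos[OF e assms(1), of "w + 1"]) simp
    show "weighted_comp u \<psi> ?e = (\<lambda>z. a ^ k * ?e z)"
      using assms(8) by (intro weighted_comp_eigenfunction[OF u assms(5,6) w]) (simp add: w_def)
  qed
qed

end
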